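(* Let $n\ge1$, let $S=(Z_1,\dots,Z_n)\sim\mathcal{P}_S=\mathcal{P}_Z^{\otimes n}$ be the input and $H=\mathcal{A}(S)$ the output of a (possibly randomised) learning algorithm $\mathcal{A}:\mathcal{Z}^n\to\mathcal{H}$, with joint law $\mathcal{P}_{SH}\ll\mathcal{P}_S\mathcal{P}_H$. Assume that for the loss function $\ell$ there exists a constant $K>0$ such that for every $h\in\mathcal{H}$ and every $\lambda>0$, $$\mathcal{P}_Z\Big(\big(\lambda(\ell(h,Z)-\mathcal{P}_Z(\ell(h,Z)))\big)^2\Big)\le K\lambda^2.$$ Then $$\text{gen-err}_{\mathcal{P}}(\mathcal{A},S)\le\sqrt{\frac{2K\left(\chi^2(\mathcal{P}_{SH}\|\mathcal{P}_S\mathcal{P}_H)+1\right)}{n}}.$$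
   Context: For a measure $\mu$ and a function $g$, $\mu(g)=\int g\,d\mu$. $\mathcal{Z}$ (instances) and $\mathcal{H}$ (hypotheses) are measurable spaces, $\mathcal{P}_Z$ is a probability measure on $\mathcal{Z}$, and $\ell:\mathcal{H}\times\mathcal{Z}\to\mathbb{R}$ is a (measurable) loss function. The risk is $L_{\mathcal{P}}(h)=\mathcal{P}_Z(\ell(h,Z))$; for $S=(z_1,\dots,z_n)$ the empirical risk is $L_S(h)=\frac1n\sum_{i=1}^n\ell(h,z_i)$. A learning algorithm is a Markov kernel from $\mathcal{Z}^n$ to $\mathcal{H}$; $\mathcal{P}_{SH}$ is the joint law of $(S,H)$, $\mathcal{P}_H$ the marginal law of $H$, and $\mathcal{P}_S\mathcal{P}_H$ the product of the marginals. The (expected) generalisation error is $$\text{gen-err}_{\mathcal{P}}(\mathcal{A},S)=\mathcal{P}_{SH}\big(L_S(H)-L_{\mathcal{P}}(H)\big),$$ with the expectations appearing assumed to be well defined. For $\nu\ll\mu$, $\chi^2(\nu\|\mu)=\mu\big((\tfrac{d\nu}{d\mu})^2\big)-1\in[0,+\infty]$. *)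

theory Defs
  imports "HOL-Probability.Probability"
begin

text \<open>
  Throughout, \<open>P\<close> is the instance distribution on the instance space and \<open>MH\<close> is the hypothesis
  space; only the underlying measurable space of \<open>MH\<close> matters, not its measure. A sample of size
  \<open>n\<close> is a function \<open>s\<close> on \<open>{..<n}\<close>.
\<close>

definition sample_law :: "nat \<Rightarrow> 'z measure \<Rightarrow> (nat \<Rightarrow> 'z) measure" where
  "sample_law n P = Pi\<^sub>M {..<n} (\<lambda>_. P)"

text \<open>A Markov kernel is a measurable map into the space of probability measures.\<close>

definition learning_algorithm ::
    "nat \<Rightarrow> 'z measure \<Rightarrow> 'h measure \<Rightarrow> ((nat \<Rightarrow> 'z) \<Rightarrow> 'h measure) \<Rightarrow> bool" where
  "learning_algorithm n P MH A \<longleftrightarrow> A \<in> sample_law n P \<rightarrow>\<^sub>M prob_algebra MH"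

definition joint_law ::
    "nat \<Rightarrow> 'z measure \<Rightarrow> 'h measure \<Rightarrow> ((nat \<Rightarrow> 'z) \<Rightarrow> 'h measure) \<Rightarrow> ((nat \<Rightarrow> 'z) \<times> 'h) measure" where
  "joint_law n P MH A =
     sample_law n P \<bind> (\<lambda>s. A s \<bind> (\<lambda>h. return (sample_law n P \<Otimes>\<^sub>M MH) (s, h)))"

definition output_law ::
    "nat \<Rightarrow> 'z measure \<Rightarrow> 'h measure \<Rightarrow> ((nat \<Rightarrow> 'z) \<Rightarrow> 'h measure) \<Rightarrow> 'h measure" where
  "output_law n P MH A = distr (joint_law n P MH A) MH snd"

definition risk :: "'z measure \<Rightarrow> ('h \<Rightarrow> 'z \<Rightarrow> real) \<Rightarrow> 'h \<Rightarrow> real" where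
  "risk P l h = (\<integral>z. l h z \<partial>P)"

definition empirical_risk :: "nat \<Rightarrow> ('h \<Rightarrow> 'z \<Rightarrow> real) \<Rightarrow> (nat \<Rightarrow> 'z) \<Rightarrow> 'h \<Rightarrow> real" where
  "empirical_risk n l s h = (1 / real n) * (\<Sum>i<n. l h (s i))"

definition gen_err ::
    "nat \<Rightarrow> 'z measure \<Rightarrow> 'h measure \<Rightarrow> ('h \<Rightarrow> 'z \<Rightarrow> real) \<Rightarrow> ((nat \<Rightarrow> 'z) \<Rightarrow> 'h measure) \<Rightarrow> real" where
  "gen_err n P MH l A =
     (\<integral>(s, h). empirical_risk n l s h - risk P l h \<partial>joint_law n P MH A)"

text \<open>
  Meaningful when \<open>absolutely_continuous \<mu> \<nu>\<close>. Note that \<open>RN_deriv \<mu> \<nu>\<close> is the density of \<open>\<nu>\<close>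
  with respect to \<open>\<mu>\<close>. The type \<open>ereal\<close> keeps the value \<open>\<infinity>\<close> and avoids truncated subtraction.
\<close>

definition chi_square_div :: "'a measure \<Rightarrow> 'a measure \<Rightarrow> ereal" where
  "chi_square_div \<nu> \<mu> = enn2ereal (\<integral>\<^sup>+ x. (RN_deriv \<mu> \<nu> x)\<^sup>2 \<partial>\<mu>) - 1"

text \<open>Square root on the nonnegative extended reals; arguments below \<open>0\<close> are not intended.\<close>

definition ereal_sqrt :: "ereal \<Rightarrow> ereal" where
  "ereal_sqrt x = (if x = \<infinity> then \<infinity> else ereal (sqrt (real_of_ereal x)))"

end

theory Submission
  imports Defs
begin

text \<open>
  Write \<open>g\<close> for the generalisation gap and \<open>D\<close> for the density of the joint law with respect to
  the product of its marginals. The generalisation error is the integral of \<open>g * D\<close> under the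
  product law, so Cauchy-Schwarz bounds it by the L2 norms of \<open>g\<close> and \<open>D\<close>. The square of the
  latter is the chi-square divergence plus one. Under the product law the hypothesis is independent
  of the sample, so given \<open>h\<close> the gap is the mean of \<open>n\<close> independent centred variables, of variance
  at most \<open>K\<close> each; hence the square of the former is at most \<open>K / n\<close>.
\<close>

lemma (in sigma_finite_measure) square_integral_le_RN_deriv:
  fixes g :: "'a \<Rightarrow> real"
  assumes "absolutely_continuous M N" "sets N = sets M"
    and [measurable]: "g \<in> borel_measurable M"
  shows "(ennreal (integral\<^sup>L N g))\<^sup>2
           \<le> (\<integral>\<^sup>+ x. ennreal ((g x)\<^sup>2) \<partial>M) * (\<integral>\<^sup>+ x. (RN_deriv M N x)\<^sup>2 \<partial>M)"
proof -
  \<comment> \<open>Two defaults make this hold for every measurable \<open>g\<close>: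
    \<open>ennreal\<close> sends a negative integral to 0, and the Bochner integral of a function
    that is not integrable is 0.\<close>
  have "ennreal (integral\<^sup>L N g) \<le> (\<integral>\<^sup>+ x. ennreal \<bar>g x\<bar> \<partial>N)"
  proof (cases "integrable N g")
    case True
    then have "ennreal (integral\<^sup>L N g) \<le> ennreal (\<integral>x. \<bar>g x\<bar> \<partial>N)"
      by (intro ennreal_leI integral_mono) auto
    also have "\<dots> = (\<integral>\<^sup>+ x. ennreal \<bar>g x\<bar> \<partial>N)"
      using True by (intro nn_integral_eq_integral[symmetric]) auto
    finally show ?thesis .
  qed (simp add: not_integrable_integral_eq)
  also have "\<dots> = (\<integral>\<^sup>+ x. RN_deriv M N x * ennreal \<bar>g x\<bar> \<partial>M)"
    by (rule RN_deriv_nn_integral) (use assms in auto)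
  finally have "(ennreal (integral\<^sup>L N g))\<^sup>2 \<le> (\<integral>\<^sup>+ x. RN_deriv M N x * ennreal \<bar>g x\<bar> \<partial>M)\<^sup>2"
    by (rule power_mono_ennreal)
  also have "\<dots> \<le> (\<integral>\<^sup>+ x. (RN_deriv M N x)\<^sup>2 \<partial>M) * (\<integral>\<^sup>+ x. (ennreal \<bar>g x\<bar>)\<^sup>2 \<partial>M)"
    by (rule Cauchy_Schwarz_nn_integral) auto
  finally show ?thesis
    by (simp add: ennreal_power mult.commute)
qed

text \<open>Distinct coordinates of a sample are independent and \<open>X\<close> is centred, so the
  off-diagonal covariances vanish. The integrand is a product of one-variable functions, to which
  Fubini for finite products applies.\<close>

lemma (in prob_space) sample_law_mult_integral:
  fixes X :: "'a \<Rightarrow> real"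
  assumes X: "integrable M X" "integrable M (\<lambda>z. (X z)\<^sup>2)" "expectation X = 0"
    and ij: "i < n" "j < n"
  shows "integrable (sample_law n M) (\<lambda>s. X (s i) * X (s j))"
    and "(\<integral>s. X (s i) * X (s j) \<partial>sample_law n M) = (if i = j then \<integral>z. (X z)\<^sup>2 \<partial>M else 0)"
proof -
  interpret product_sigma_finite "\<lambda>_ :: nat. M" ..
  \<comment> \<open>\<open>f k\<close> is \<open>X\<close> to the power of how many of
    \<open>i\<close>, \<open>j\<close> equal \<open>k\<close>. This one family serves both cases:
    for \<open>i = j\<close> both factors give \<open>X\<close>, and elsewhere the factor 1
    integrates to 1.\<close>
  define f where "f = (\<lambda>k z. (if k = i then X z else 1) * (if k = j then X z else 1))"
  have int: "integrable M (f k)" for k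
    using X(1,2) by (cases "k = i"; cases "k = j") (simp_all add: f_def power2_eq_square)
  have prod: "(\<Prod>k<n. f k (s k)) = X (s i) * X (s j)" for s
    unfolding f_def prod.distrib using ij by (simp add: prod.delta)
  show "integrable (sample_law n M) (\<lambda>s. X (s i) * X (s j))"
    using product_integrable_prod[of "{..<n}" f] int by (simp add: prod sample_law_def)
  have "(\<integral>s. X (s i) * X (s j) \<partial>sample_law n M) = (\<Prod>k<n. integral\<^sup>L M (f k))"
    using product_integral_prod[of "{..<n}" f] int by (simp add: prod sample_law_def)
  also have "\<dots> = (if i = j then \<integral>z. (X z)\<^sup>2 \<partial>M else 0)"
  proof (cases "i = j")
    case True
    then have "(\<Prod>k<n. integral\<^sup>L M (f k)) = (\<Prod>k<n. if k = i then \<integral>z. (X z)\<^sup>2 \<partial>M else 1)"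
      by (intro prod.cong) (auto simp: f_def power2_eq_square prob_space)
    with True ij show ?thesis by (simp add: prod.delta)
  next
    case False
    then have "integral\<^sup>L M (f i) = 0" using X(3) by (simp add: f_def)
    with False ij show ?thesis by (auto intro!: prod_zero)
  qed
  finally show "(\<integral>s. X (s i) * X (s j) \<partial>sample_law n M) = (if i = j then \<integral>z. (X z)\<^sup>2 \<partial>M else 0)" .
qed

text \<open>Expanding the square gives a double sum in which only the \<open>n\<close> diagonal
  terms survive integration. The nonnegative integral is used because the result becomes the inner
  integral in Tonelli's theorem.\<close>

lemma (in prob_space) sample_mean_second_moment:
  fixes X :: "'a \<Rightarrow> real"
  assumes X: "integrable M X" "integrable M (\<lambda>z. (X z)\<^sup>2)" "expectation X = 0"
    and n: "n \<ge> 1"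
  shows "(\<integral>\<^sup>+ s. ennreal ((1 / real n * (\<Sum>i<n. X (s i)))\<^sup>2) \<partial>sample_law n M)
           = ennreal ((\<integral>z. (X z)\<^sup>2 \<partial>M) / real n)"
proof -
  note moment = sample_law_mult_integral[OF X]
  have sq: "(1 / real n * (\<Sum>i<n. X (s i)))\<^sup>2 = (\<Sum>i<n. \<Sum>j<n. X (s i) * X (s j)) / (real n)\<^sup>2" for s
    by (simp add: power_divide power2_eq_square sum_product)
  have "(\<integral>s. (\<Sum>i<n. \<Sum>j<n. X (s i) * X (s j)) \<partial>sample_law n M)
      = (\<Sum>i<n. \<integral>s. (\<Sum>j<n. X (s i) * X (s j)) \<partial>sample_law n M)"
    by (intro Bochner_Integration.integral_sum Bochner_Integration.integrable_sum moment) auto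
  also have "\<dots> = (\<Sum>i<n. \<Sum>j<n. \<integral>s. X (s i) * X (s j) \<partial>sample_law n M)"
    by (intro sum.cong refl Bochner_Integration.integral_sum moment) auto
  also have "\<dots> = (\<Sum>i<n. \<integral>z. (X z)\<^sup>2 \<partial>M)"
    by (simp add: moment)
  \<comment> \<open>The calculation is substituted into a quotient here, so from now on its
    left-hand side is divided by \<open>(real n)\<^sup>2\<close> too; one factor
    \<open>real n\<close> cancels.\<close>
  also have "\<dots> / (real n)\<^sup>2 = (\<integral>z. (X z)\<^sup>2 \<partial>M) / real n"
    using n by (simp add: power2_eq_square)
  finally have val: "(\<integral>s. (1 / real n * (\<Sum>i<n. X (s i)))\<^sup>2 \<partial>sample_law n M) = (\<integral>z. (X z)\<^sup>2 \<partial>M) / real n"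
    by (simp only: sq integral_divide_zero)
  have "integrable (sample_law n M) (\<lambda>s. (1 / real n * (\<Sum>i<n. X (s i)))\<^sup>2)"
    unfolding sq by (intro integrable_divide Bochner_Integration.integrable_sum moment) auto
  then show ?thesis
    by (subst nn_integral_eq_integral) (simp_all only: val zero_le_power2 AE_I2)
qed

lemma gap_second_moment:
  fixes l :: "'h \<Rightarrow> 'z \<Rightarrow> real" and K :: real
  assumes "prob_space P" and n: "n \<ge> 1" and lh: "integrable P (l h)" and K: "K \<ge> 0"
    and bound: "(\<integral>\<^sup>+ z. ennreal ((l h z - risk P l h)\<^sup>2) \<partial>P) \<le> ennreal K"
  shows "(\<integral>\<^sup>+ s. ennreal ((empirical_risk n l s h - risk P l h)\<^sup>2) \<partial>sample_law n P)
           \<le> ennreal (K / real n)"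
proof -
  interpret prob_space P by fact
  define X where "X = (\<lambda>z. l h z - risk P l h)"
  have X: "integrable P X" "expectation X = 0"
    using lh by (simp_all add: X_def risk_def prob_space)
  \<comment> \<open>Being a bound on a nonnegative integral, \<open>bound\<close> also says that the
    second moment is finite, which yields integrability of the square.\<close>
  have "(\<integral>\<^sup>+ z. ennreal ((X z)\<^sup>2) \<partial>P) < \<infinity>"
    using bound by (simp add: X_def order_le_less_trans[OF _ ennreal_less_top])
  then have X2: "integrable P (\<lambda>z. (X z)\<^sup>2)"
    using borel_measurable_integrable[OF X(1)] by (intro integrableI_bounded) simp_all
  have "ennreal (\<integral>z. (X z)\<^sup>2 \<partial>P) \<le> ennreal K"
    using bound X2 by (simp add: X_def nn_integral_eq_integral)
  then have var: "(\<integral>z. (X z)\<^sup>2 \<partial>P) \<le> K"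
    using K by simp
  have "empirical_risk n l s h - risk P l h = 1 / real n * (\<Sum>i<n. X (s i))" for s
    using n by (simp add: empirical_risk_def X_def sum_subtractf field_simps)
  then have "(\<integral>\<^sup>+ s. ennreal ((empirical_risk n l s h - risk P l h)\<^sup>2) \<partial>sample_law n P)
      = ennreal ((\<integral>z. (X z)\<^sup>2 \<partial>P) / real n)"
    by (simp only: sample_mean_second_moment[OF X(1) X2 X(2) n])
  also have "\<dots> \<le> ennreal (K / real n)"
    by (intro ennreal_leI divide_right_mono var) simp
  finally show ?thesis .
qed

lemma prob_space_sample_law:
  "prob_space P \<Longrightarrow> prob_space (sample_law n P)"
  unfolding sample_law_def by (intro prob_space_PiM)

text \<open>Sampling and then applying the kernel is a bind of probability kernels. The
  sigma-algebra is recorded because measurability under the joint law and its density both depend on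
  it.\<close>

lemma
  assumes "prob_space P" "learning_algorithm n P MH A"
  shows prob_space_joint_law: "prob_space (joint_law n P MH A)"
    and sets_joint_law: "sets (joint_law n P MH A) = sets (sample_law n P \<Otimes>\<^sub>M MH)"
proof -
  let ?S = "sample_law n P"
  have [measurable]: "A \<in> ?S \<rightarrow>\<^sub>M prob_algebra MH"
    using assms(2) by (simp add: learning_algorithm_def)
  have S: "?S \<in> space (prob_algebra ?S)"
    using prob_space_sample_law[OF assms(1)] by (simp add: space_prob_algebra)
  have B: "(\<lambda>s. A s \<bind> (\<lambda>h. return (?S \<Otimes>\<^sub>M MH) (s, h))) \<in> ?S \<rightarrow>\<^sub>M prob_algebra (?S \<Otimes>\<^sub>M MH)"
    by measurable
  show "prob_space (joint_law n P MH A)" "sets (joint_law n P MH A) = sets (?S \<Otimes>\<^sub>M MH)"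
    unfolding joint_law_def using prob_space_bind'[OF S B] sets_bind'[OF S B] by simp_all
qed

text \<open>Turns the squared Cauchy-Schwarz bound into the form of the theorem. A negative
  \<open>r\<close> lies below any square root, and an infinite \<open>x\<close> makes the right-hand
  side infinite.\<close>

lemma ereal_le_ereal_sqrt:
  assumes "(ennreal r)\<^sup>2 \<le> x"
  shows "ereal r \<le> ereal_sqrt (enn2ereal x)"
proof (cases x)
  case (real y)
  have "r \<le> sqrt y"
  proof (cases "r \<ge> 0")
    case True
    with assms real have "r\<^sup>2 \<le> y" by (simp add: ennreal_power)
    then show ?thesis by (rule real_le_rsqrt)
  next
    case False
    with real show ?thesis by (smt (verit) real_sqrt_ge_zero)
  qed
  with real show ?thesis by (simp add: ereal_sqrt_def enn2ereal_ennreal)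
qed (simp add: ereal_sqrt_def)

theorem corollary4:
  fixes n :: nat and P :: "'z measure" and MH :: "'h measure"
    and l :: "'h \<Rightarrow> 'z \<Rightarrow> real" and A :: "(nat \<Rightarrow> 'z) \<Rightarrow> 'h measure" and K :: real
  assumes "n \<ge> 1"
    and "prob_space P"
    and "(\<lambda>(h, z). l h z) \<in> borel_measurable (MH \<Otimes>\<^sub>M P)"
    and "learning_algorithm n P MH A"
    and "absolutely_continuous (sample_law n P \<Otimes>\<^sub>M output_law n P MH A) (joint_law n P MH A)"
    and "\<And>h. h \<in> space MH \<Longrightarrow> integrable P (l h)"
    and "integrable (joint_law n P MH A) (\<lambda>(s, h). empirical_risk n l s h - risk P l h)"
    and "K > 0"
    and "\<And>h t. h \<in> space MH \<Longrightarrow> t > 0 \<Longrightarrow>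
           (\<integral>\<^sup>+ z. ennreal ((t * (l h z - (\<integral>z'. l h z' \<partial>P)))\<^sup>2) \<partial>P) \<le> ennreal (K * t\<^sup>2)"
  shows "ereal (gen_err n P MH l A) \<le>
           ereal_sqrt (2 * ereal K *
             (chi_square_div (joint_law n P MH A) (sample_law n P \<Otimes>\<^sub>M output_law n P MH A) + 1)
             / ereal (real n))"
proof -
  let ?S = "sample_law n P" and ?H = "output_law n P MH A" and ?J = "joint_law n P MH A"
  let ?M = "?S \<Otimes>\<^sub>M ?H"
  let ?g = "\<lambda>(s, h). empirical_risk n l s h - risk P l h"
  let ?I = "\<integral>\<^sup>+ x. (RN_deriv ?M ?J x)\<^sup>2 \<partial>?M"
  interpret P: prob_space P by fact
  interpret S: prob_space ?S by (rule prob_space_sample_law) fact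
  interpret J: prob_space ?J by (rule prob_space_joint_law) fact+
  note sets_J[measurable_cong] = sets_joint_law[OF assms(2,4)]
  have sets_H[measurable_cong]: "sets ?H = sets MH"
    by (simp add: output_law_def)
  have space_H: "space ?H = space MH"
    using sets_H by (rule sets_eq_imp_space_eq)
  interpret H: prob_space ?H
    unfolding output_law_def by (rule J.prob_space_distr) measurable
  interpret SH: pair_prob_space ?S ?H ..
  have [measurable]: "(\<lambda>(h, z). l h z) \<in> borel_measurable (MH \<Otimes>\<^sub>M P)" by fact
  have [measurable]: "(\<lambda>h. risk P l h) \<in> borel_measurable MH"
    unfolding risk_def by measurable
  have [measurable]: "(\<lambda>s. s i) \<in> ?S \<rightarrow>\<^sub>M P" if "i < n" for i
    unfolding sample_law_def using that by (intro measurable_component_singleton) simp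
  have g[measurable]: "?g \<in> borel_measurable ?M"
    unfolding empirical_risk_def by measurable
  \<comment> \<open>Under the product law the sample can be integrated out first with
    \<open>h\<close> fixed, which reduces the claim to the variance bound for a single
    hypothesis.\<close>
  have "(\<integral>\<^sup>+ x. ennreal ((?g x)\<^sup>2) \<partial>?M) = (\<integral>\<^sup>+ h. (\<integral>\<^sup>+ s. ennreal ((?g (s, h))\<^sup>2) \<partial>?S) \<partial>?H)"
    by (rule SH.nn_integral_snd[symmetric]) measurable
  also have "\<dots> \<le> (\<integral>\<^sup>+ h. ennreal (K / real n) \<partial>?H)"
  proof (rule nn_integral_mono)
    fix h assume "h \<in> space ?H"
    then have h: "h \<in> space MH" by (simp add: space_H)
    show "(\<integral>\<^sup>+ s. ennreal ((?g (s, h))\<^sup>2) \<partial>?S) \<le> ennreal (K / real n)"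
      \<comment> \<open>The choice \<open>t = 1\<close> turns the assumed bound into variance at
        most \<open>K\<close>.\<close>
      using gap_second_moment[of P n l h K] assms(1,2,8) assms(6)[OF h] assms(9)[OF h, of 1]
      by (simp add: risk_def)
  qed
  also have "\<dots> = ennreal (K / real n)"
    by (simp add: H.emeasure_space_1)
  \<comment> \<open>The factor 2 of the claimed bound enters here, by weakening.\<close>
  also have "\<dots> \<le> ennreal (2 * K / real n)"
    using assms(8) by (intro ennreal_leI divide_right_mono) simp_all
  finally have gap: "(\<integral>\<^sup>+ x. ennreal ((?g x)\<^sup>2) \<partial>?M) \<le> ennreal (2 * K / real n)" .
  have "sets ?J = sets ?M"
    using sets_J sets_H by (simp cong: sets_pair_measure_cong)
  then have "(ennreal (integral\<^sup>L ?J ?g))\<^sup>2 \<le> (\<integral>\<^sup>+ x. ennreal ((?g x)\<^sup>2) \<partial>?M) * ?I"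
    using assms(5) g by (intro SH.square_integral_le_RN_deriv)
  also have "\<dots> \<le> ennreal (2 * K / real n) * ?I"
    by (rule mult_right_mono[OF gap]) simp
  finally have "ereal (gen_err n P MH l A) \<le> ereal_sqrt (enn2ereal (ennreal (2 * K / real n) * ?I))"
    unfolding gen_err_def by (rule ereal_le_ereal_sqrt)
  \<comment> \<open>Adding 1 undoes the \<open>- 1\<close> in \<open>chi_square_div\<close>. If the
    second moment of the density is infinite, both sides are \<infinity>, since
    \<open>2 * K / real n\<close> is positive.\<close>
  also have "enn2ereal (ennreal (2 * K / real n) * ?I) = 2 * ereal K * (chi_square_div ?J ?M + 1) / ereal (real n)"
  proof (cases ?I)
    case (real i)
    then show ?thesis
      using assms(1,8) unfolding chi_square_div_def
      by (simp add: enn2ereal_ennreal one_ereal_def times_ennreal.rep_eq)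
  next
    case top
    then show ?thesis
      using assms(1,8) unfolding chi_square_div_def
      by (simp add: times_ennreal.rep_eq enn2ereal_ennreal)
  qed
  finally show ?thesis .
qed

end
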